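(* Let $G$ be a graph with $n$ vertices, $2n-2$ edges and no proper (not necessarily induced) subgraph with minimum degree $3$. Then $G$ is pancyclic, that is, it contains a cycle of length $i$ for every integer $i$ with $3\le i\le n$.
   Context: All graphs are finite and simple. A subgraph $H$ of $G$ is proper if $H\neq G$; here subgraphs need not be induced. "Minimum degree $3$" for a forbidden subgraph may be read as "minimum degree at least $3$". "Contains a cycle of length $i$" means contains a (not necessarily induced) subgraph that is a cycle on $i$ vertices. *)

theory Defs
  imports Main
begin

record 'a sgraph =
  verts :: "'a set"
  edges :: "'a set set"

definition fin_simple_graph :: "'a sgraph \<Rightarrow> bool" where
  "fin_simple_graph G \<longleftrightarrow>
     finite (verts G) \<and> (\<forall>e\<in>edges G. e \<subseteq> verts G \<and> card e = 2)"

text \<open>Subgraphs are not necessarily induced: an arbitrary subset of the edges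
  inside the chosen vertex set may be kept.\<close>

definition subgraph :: "'a sgraph \<Rightarrow> 'a sgraph \<Rightarrow> bool" where
  "subgraph H G \<longleftrightarrow>
     fin_simple_graph H \<and> verts H \<subseteq> verts G \<and> edges H \<subseteq> edges G"

definition proper_subgraph :: "'a sgraph \<Rightarrow> 'a sgraph \<Rightarrow> bool" where
  "proper_subgraph H G \<longleftrightarrow> subgraph H G \<and> H \<noteq> G"

definition degree :: "'a sgraph \<Rightarrow> 'a \<Rightarrow> nat" where
  "degree G v = card {e \<in> edges G. v \<in> e}"

text \<open>Only meaningful if the vertex set is finite and nonempty, since \<^term>\<open>Min {}\<close>
  is unspecified.\<close>

definition min_degree :: "'a sgraph \<Rightarrow> nat" where
  "min_degree G = Min (degree G ` verts G)"

definition is_cycle :: "'a sgraph \<Rightarrow> bool" where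
  "is_cycle C \<longleftrightarrow>
     (\<exists>vs. 3 \<le> length vs \<and> distinct vs \<and> verts C = set vs \<and>
        edges C = {{vs ! j, vs ! (Suc j mod length vs)} | j. j < length vs})"

definition contains_cycle_of_length :: "'a sgraph \<Rightarrow> nat \<Rightarrow> bool" where
  "contains_cycle_of_length G i \<longleftrightarrow>
     (\<exists>C. subgraph C G \<and> is_cycle C \<and> card (verts C) = i)"

definition pancyclic :: "'a sgraph \<Rightarrow> bool" where
  "pancyclic G \<longleftrightarrow>
     (\<forall>i. 3 \<le> i \<and> i \<le> card (verts G) \<longrightarrow> contains_cycle_of_length G i)"

end

theory Submission
  imports Defs
begin

text \<open>
  Every proper induced subgraph has a vertex of degree at most 2, so a set of \<open>k\<close> vertices, for
  \<open>2 \<le> k < n\<close>, spans at most \<open>2k - 3\<close> edges; deleting an edge also creates such a vertex, so the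
  vertices of degree at least 4 (the hubs) are independent. Consider the components of the
  subgraph on the cubic vertices. A component of size \<open>t\<close> meets at most \<open>2t + 1\<close> of the \<open>2n - 2\<close>
  edges, so with \<open>b\<close> hubs there are at least \<open>2b - 2\<close> components. Removing a component leaves some
  hub with at most 2 neighbours, and when \<open>b \<ge> 3\<close> distinct components give distinct hubs; hence
  \<open>2b - 2 \<le> b\<close> and \<open>b \<le> 2\<close>. If \<open>b \<le> 1\<close>, the graph is a wheel. If \<open>b = 2\<close>, there are two components,
  each spanned by a path all of whose vertices are joined to one hub and one end of which is
  joined to the other hub. Cycles of all lengths can then be read off.
\<close>

text \<open>The hypothesis on proper subgraphs is kept in the two forms that the argument needs:
  passing to a proper induced subgraph, and deleting a single edge. Cycle lengths start at 3, so
  graphs on fewer than three vertices are left out.\<close>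

locale critical_graph =
  fixes V :: "'a set" and E :: "'a set set"
  assumes finV: "finite V"
    and edgeD: "e \<in> E \<Longrightarrow> e \<subseteq> V \<and> card e = 2"
    and card_V: "3 \<le> card V"
    and card_E: "card E + 2 = 2 * card V"
    and low_degree_induced:
      "\<lbrakk>S \<subseteq> V; S \<noteq> V; S \<noteq> {}\<rbrakk> \<Longrightarrow> \<exists>v\<in>S. card {e \<in> E. e \<subseteq> S \<and> v \<in> e} \<le> 2"
    and low_degree_delete: "e \<in> E \<Longrightarrow> \<exists>v\<in>V. card {f \<in> E - {e}. v \<in> f} \<le> 2"
begin

definition deg :: "'a \<Rightarrow> nat" where "deg v = card {e \<in> E. v \<in> e}"
definition touch :: "'a set \<Rightarrow> 'a set set" where "touch T = {e \<in> E. e \<inter> T \<noteq> {}}"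
definition inside :: "'a set \<Rightarrow> 'a set set" where "inside S = {e \<in> E. e \<subseteq> S}"
definition nb :: "'a \<Rightarrow> 'a set" where "nb x = {y. {x, y} \<in> E}"
definition cubic :: "'a set" where "cubic = {x \<in> V. deg x = 3}"
text \<open>These are exactly the unions of connected components of the subgraph induced on the
  cubic vertices.\<close>

definition closed :: "'a set \<Rightarrow> bool" where
  "closed X \<longleftrightarrow> X \<subseteq> cubic \<and> (\<forall>x\<in>X. nb x \<inter> cubic \<subseteq> X)"
text \<open>A minimal nonempty closed set is the vertex set of a connected component of the subgraph
  induced on \<^term>\<open>cubic\<close>.\<close>

definition component :: "'a set \<Rightarrow> bool" where
  "component C \<longleftrightarrow> closed C \<and> C \<noteq> {} \<and> (\<forall>X. closed X \<longrightarrow> X \<subseteq> C \<longrightarrow> X \<noteq> {} \<longrightarrow> X = C)"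

section \<open>Edges and neighbourhoods\<close>

lemma finE: "finite E"
  using edgeD finV by (meson Pow_iff finite_Pow_iff finite_subset subsetI)

lemma fin_touch [simp]: "finite (touch T)" and fin_inside [simp]: "finite (inside S)"
  using finE by (auto simp: touch_def inside_def)

lemma nb_sym: "y \<in> nb x \<longleftrightarrow> x \<in> nb y"
  by (simp add: nb_def insert_commute)

lemma nb_V: "y \<in> nb x \<Longrightarrow> x \<in> V \<and> y \<in> V \<and> x \<noteq> y"
  using edgeD[of "{x, y}"] by (auto simp: nb_def)

lemma fin_nb [simp]: "finite (nb x)"
  using nb_V finV by (meson finite_subset subsetI)

lemma edge_pair: assumes "e \<in> E" "v \<in> e" obtains y where "e = {v, y}" "y \<in> nb v"
proof -
  obtain x y where xy: "e = {x, y}" "x \<noteq> y"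
    using edgeD[OF assms(1)] by (meson card_2_iff)
  show thesis
  proof (cases "v = x")
    case True then show thesis using that[of y] xy assms(1) by (simp add: nb_def)
  next
    case False
    then have "e = {v, x}" using xy assms(2) by auto
    then show thesis using that[of x] assms(1) by (simp add: nb_def)
  qed
qed

lemma star_image: "{e \<in> E. v \<in> e \<and> e \<subseteq> insert v S} = (\<lambda>y. {v, y}) ` (nb v \<inter> S)"
proof (intro set_eqI iffI)
  fix e assume e: "e \<in> {e \<in> E. v \<in> e \<and> e \<subseteq> insert v S}"
  then obtain y where y: "e = {v, y}" "y \<in> nb v" using edge_pair[of e v] by blast
  then have "y \<in> S" using e nb_V[of y v] by auto
  then show "e \<in> (\<lambda>y. {v, y}) ` (nb v \<inter> S)" using y by auto
qed (auto simp: nb_def)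

lemma card_star: "card {e \<in> E. v \<in> e \<and> e \<subseteq> insert v S} = card (nb v \<inter> S)"
  unfolding star_image by (rule card_image) (auto simp: inj_on_def doubleton_eq_iff)

lemma card_nb: "card (nb v) = deg v"
proof -
  have "{e \<in> E. v \<in> e \<and> e \<subseteq> insert v V} = {e \<in> E. v \<in> e}" using edgeD by blast
  moreover have "nb v \<inter> V = nb v" using nb_V by blast
  ultimately show ?thesis using card_star[of v V] by (simp add: deg_def)
qed

section \<open>Sparsity of proper vertex subsets\<close>

text \<open>A vertex of degree at most 2 in the induced subgraph is stripped off, at a cost of at
  most two edges, until two vertices are left; these span at most one edge.\<close>

lemma card_inside:
  assumes "S \<subseteq> V" "S \<noteq> V" "2 \<le> card S"
  shows "card (inside S) + 3 \<le> 2 * card S"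
  using assms
proof (induction "card S" arbitrary: S)
  case 0 then show ?case by simp
next
  case (Suc m)
  have finS: "finite S" using Suc.prems(1) finV finite_subset by blast
  show ?case
  proof (cases "card S = 2")
    case True
    have "inside S \<subseteq> {S}"
    proof
      fix e assume "e \<in> inside S"
      then have "e \<subseteq> S" "card e = card S" using True edgeD by (auto simp: inside_def)
      then show "e \<in> {S}" using card_subset_eq[OF finS] by blast
    qed
    then have "card (inside S) \<le> card {S}" by (intro card_mono) auto
    then show ?thesis using True by simp
  next
    case False
    have "S \<noteq> {}" using Suc.prems(3) by auto
    then obtain v where v: "v \<in> S" "card {e \<in> E. e \<subseteq> S \<and> v \<in> e} \<le> 2"
      using low_degree_induced[OF Suc.prems(1,2)] by blast
    have "inside S = inside (S - {v}) \<union> {e \<in> E. e \<subseteq> S \<and> v \<in> e}"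
      by (auto simp: inside_def)
    then have le: "card (inside S) \<le> card (inside (S - {v})) + card {e \<in> E. e \<subseteq> S \<and> v \<in> e}"
      by (simp add: card_Un_le)
    have c: "card (S - {v}) = m" "card S = Suc m" using v(1) Suc.hyps(2) finS by auto
    have "card (inside (S - {v})) + 3 \<le> 2 * card (S - {v})"
      using Suc.hyps(1)[of "S - {v}"] c False Suc.prems v(1) by auto
    then show ?thesis using le v(2) c by simp
  qed
qed

lemma touch_inside: "T \<subseteq> V \<Longrightarrow> card (touch T) + card (inside (V - T)) = card E"
proof -
  have "touch T \<union> inside (V - T) = E" "touch T \<inter> inside (V - T) = {}"
    using edgeD by (auto simp: touch_def inside_def)
  then show ?thesis using card_Un_disjoint[of "touch T" "inside (V - T)"] by simp
qed

text \<open>The complement of \<open>T\<close> is a proper subset with at least two vertices. By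
  sparsity at least (2n - 2) - (2(n - t) - 3) = 2t + 1 edges are not inside it, where t is the size
  of \<open>T\<close>.\<close>

lemma card_touch_ge:
  assumes "T \<subseteq> V" "T \<noteq> {}" "card T + 2 \<le> card V"
  shows "2 * card T + 1 \<le> card (touch T)"
proof -
  have "card (V - T) = card V - card T" using assms(1) finV by (simp add: card_Diff_subset finite_subset)
  moreover have "V - T \<noteq> V" using assms by blast
  then have "card (inside (V - T)) + 3 \<le> 2 * card (V - T)"
    using card_inside[of "V - T"] assms(3) calculation by simp
  ultimately show ?thesis using touch_inside[OF assms(1)] card_E assms(3) by linarith
qed

lemma deg_ge: assumes "v \<in> V" shows "3 \<le> deg v"
proof -
  have "touch {v} = {e \<in> E. v \<in> e}" by (auto simp: touch_def)
  then show ?thesis using card_touch_ge[of "{v}"] assms card_V by (simp add: deg_def)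
qed

text \<open>Deleting the edge pushes some vertex below degree 3. Only an end of the edge loses
  degree, and it loses just one, so that end had degree exactly 3.\<close>

lemma edge_meets_cubic: assumes "y \<in> nb x" shows "x \<in> cubic \<or> y \<in> cubic"
proof -
  have e: "{x, y} \<in> E" using assms by (simp add: nb_def)
  obtain v where v: "v \<in> V" "card {f \<in> E - {{x, y}}. v \<in> f} \<le> 2"
    using low_degree_delete[OF e] by blast
  have ge: "3 \<le> card {f \<in> E. v \<in> f}" using deg_ge[OF v(1)] by (simp add: deg_def)
  have "{f \<in> E. v \<in> f} \<subseteq> insert {x, y} {f \<in> E - {{x, y}}. v \<in> f}" by auto
  then have "card {f \<in> E. v \<in> f} \<le> card (insert {x, y} {f \<in> E - {{x, y}}. v \<in> f})"
    using finE by (intro card_mono) auto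
  also have "\<dots> \<le> Suc (card {f \<in> E - {{x, y}}. v \<in> f})" by (rule card_insert_le_m1) auto
  finally have d3: "deg v = 3" using v(2) ge by (simp add: deg_def)
  have "v \<in> {x, y}"
  proof (rule ccontr)
    assume "v \<notin> {x, y}"
    then have "{f \<in> E - {{x, y}}. v \<in> f} = {f \<in> E. v \<in> f}" by auto
    then show False using ge v(2) by simp
  qed
  then show ?thesis using d3 v(1) by (auto simp: cubic_def)
qed

text \<open>Double counting: an edge with one end in \<open>C\<close> is counted once, and an edge
  with both ends there is counted once in each summand on the right.\<close>

lemma sum_deg:
  assumes "C \<subseteq> V" shows "(\<Sum>x\<in>C. deg x) = card (touch C) + card (inside C)"
proof -
  have finC: "finite C" using assms finV finite_subset by blast
  have "(\<Sum>x\<in>C. deg x) = (\<Sum>x\<in>C. \<Sum>e | e \<in> E \<and> x \<in> e. 1)"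
    by (simp add: deg_def)
  also have "\<dots> = (\<Sum>e\<in>E. \<Sum>x | x \<in> C \<and> x \<in> e. 1)"
    by (rule sum.swap_restrict[OF finC finE])
  also have "\<dots> = (\<Sum>e\<in>E. (if e \<inter> C \<noteq> {} then 1 else 0) + (if e \<subseteq> C then 1 else 0))"
  proof (rule sum.cong[OF refl])
    fix e assume "e \<in> E"
    then obtain x y where xy: "e = {x, y}" "x \<noteq> y" using edgeD by (meson card_2_iff)
    have "{z. z \<in> C \<and> z \<in> e} = (if x \<in> C then {x} else {}) \<union> (if y \<in> C then {y} else {})"
      using xy by auto
    then show "(\<Sum>x | x \<in> C \<and> x \<in> e. 1) =
        (if e \<inter> C \<noteq> {} then 1 else 0) + (if e \<subseteq> C then 1 else 0 :: nat)"
      using xy by auto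
  qed
  also have "\<dots> = card (touch C) + card (inside C)"
    unfolding sum.distrib touch_def inside_def using finE
    by (simp add: sum.If_cases Int_def)
  finally show ?thesis .
qed

section \<open>Components of the cubic subgraph\<close>

lemma closed_Diff: assumes "closed X" "closed Y" shows "closed (X - Y)"
  using assms nb_sym unfolding closed_def by blast

lemma closed_cubic: "closed cubic" by (auto simp: closed_def)

lemma cubic_V: "cubic \<subseteq> V" by (auto simp: cubic_def)

lemma component_exists:
  assumes "x \<in> cubic" shows "\<exists>C. component C \<and> x \<in> C"
proof -
  obtain C where C: "closed C" "x \<in> C" and
    min: "\<And>X. closed X \<Longrightarrow> x \<in> X \<Longrightarrow> card C \<le> card X"
    using ex_has_least_nat[of "\<lambda>X. closed X \<and> x \<in> X" cubic card] closed_cubic assms by blast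
  have finC: "finite C" using C(1) cubic_V finV by (meson closed_def finite_subset)
  \<comment> \<open>Either \<open>X\<close> or \<open>C - X\<close> is a closed set containing
    \<open>x\<close>, and both are smaller than the minimal \<open>C\<close>.\<close>
  have "X = C" if X: "closed X" "X \<subseteq> C" "X \<noteq> {}" for X
  proof (rule ccontr)
    assume "X \<noteq> C"
    then have "card X < card C" using X finC by (meson psubsetI psubset_card_mono)
    moreover have "card (C - X) < card C" using X finC by (intro psubset_card_mono) auto
    ultimately show False using min[of X] min[of "C - X"] X closed_Diff[OF C(1) X(1)] C(2) by force
  qed
  then show ?thesis using C by (auto simp: component_def)
qed

lemma component_disjoint:
  assumes "component C" "component D" "C \<noteq> D" shows "C \<inter> D = {}"
proof (rule ccontr)
  assume "C \<inter> D \<noteq> {}"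
  \<comment> \<open>Written as a double difference, the intersection is closed by
    \<open>closed_Diff\<close>; minimality then identifies it with both components.\<close>
  moreover have "C \<inter> D = C - (C - D)" by auto
  moreover have "closed (C - (C - D))" using assms closed_Diff by (auto simp: component_def)
  ultimately show False using assms unfolding component_def
    by (metis inf.cobounded1 inf.cobounded2)
qed

lemma touch_insert:
  assumes "y \<in> cubic" "x \<in> S" "x \<in> nb y"
  shows "card (touch (insert y S)) \<le> card (touch S) + 2"
proof -
  have "touch (insert y S) \<subseteq> touch S \<union> ({e \<in> E. y \<in> e} - {{y, x}})"
    using assms by (auto simp: touch_def)
  then have "card (touch (insert y S)) \<le> card (touch S \<union> ({e \<in> E. y \<in> e} - {{y, x}}))"
    using finE by (intro card_mono) auto
  also have "\<dots> \<le> card (touch S) + card ({e \<in> E. y \<in> e} - {{y, x}})" by (rule card_Un_le)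
  also have "card ({e \<in> E. y \<in> e} - {{y, x}}) = 2"
    using assms finE by (subst card_Diff_singleton) (auto simp: nb_def cubic_def deg_def)
  finally show ?thesis .
qed

text \<open>The component is grown one vertex at a time. The first vertex meets 3 edges; each later
  one is joined to an earlier one, so it adds at most 2.\<close>

lemma card_touch_component:
  assumes "component C" shows "card (touch C) \<le> 2 * card C + 1"
proof -
  have C: "closed C" "C \<noteq> {}" using assms by (auto simp: component_def)
  have finC: "finite C" using C(1) cubic_V finV by (meson closed_def finite_subset)
  have "\<exists>S\<subseteq>C. card S = Suc k \<and> card (touch S) \<le> 2 * card S + 1" if "Suc k \<le> card C" for k
    using that
  proof (induction k)
    case 0
    obtain x where x: "x \<in> C" using C(2) by blast
    then have "deg x = 3" using C(1) by (auto simp: closed_def cubic_def)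
    moreover have "touch {x} = {e \<in> E. x \<in> e}" by (auto simp: touch_def)
    ultimately show ?case using x by (intro exI[of _ "{x}"]) (simp add: deg_def)
  next
    case (Suc k)
    then obtain S where S: "S \<subseteq> C" "card S = Suc k" "card (touch S) \<le> 2 * card S + 1" by auto
    then have "S \<noteq> C" "S \<noteq> {}" using Suc.prems by auto
    \<comment> \<open>A nonempty proper subset of a component cannot be closed, and the failure
      supplies the next vertex.\<close>
    then have "\<not> closed S" using assms S(1) unfolding component_def by blast
    then obtain x y where xy: "x \<in> S" "y \<in> nb x" "y \<in> cubic" "y \<notin> S"
      using S(1) C(1) unfolding closed_def by blast
    then have "y \<in> C" using S(1) C(1) unfolding closed_def by blast
    moreover have "card (touch (insert y S)) \<le> card (touch S) + 2"
      using touch_insert xy nb_sym by blast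
    moreover have "card (insert y S) = Suc (card S)"
      using xy S(1) finC by (meson card_insert_disjoint finite_subset)
    ultimately show ?case using S by (intro exI[of _ "insert y S"]) auto
  qed
  from this[of "card C - 1"] obtain S where S: "S \<subseteq> C" "card S = card C"
    "card (touch S) \<le> 2 * card S + 1"
    using C(2) finC by (metis Suc_diff_1 card_gt_0_iff order_refl)
  then have "S = C" using finC card_subset_eq by blast
  then show ?thesis using S by simp
qed

section \<open>Bounding the number of hubs\<close>

lemma touch_cubic: "touch cubic = E"
proof -
  have "e \<inter> cubic \<noteq> {}" if e: "e \<in> E" for e
  proof -
    obtain x where "x \<in> e" using edgeD[OF e] by fastforce
    then obtain y where "e = {x, y}" "y \<in> nb x" using edge_pair e by blast
    then show ?thesis using edge_meets_cubic by auto
  qed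
  then show ?thesis by (auto simp: touch_def)
qed

lemma card_cubic: "card cubic + card (V - cubic) = card V"
  using cubic_V finV by (metis card_Diff_subset card_mono finite_subset le_add_diff_inverse)

lemma low_degree_nb:
  assumes "S \<subseteq> V" "S \<noteq> V" "S \<noteq> {}" shows "\<exists>v\<in>S. card (nb v \<inter> S) \<le> 2"
proof -
  obtain v where v: "v \<in> S" "card {e \<in> E. e \<subseteq> S \<and> v \<in> e} \<le> 2"
    using low_degree_induced[OF assms] by blast
  have "{e \<in> E. e \<subseteq> S \<and> v \<in> e} = {e \<in> E. v \<in> e \<and> e \<subseteq> insert v S}"
    using v(1) by auto
  then show ?thesis using v card_star[of v S] by auto
qed

text \<open>Removing a closed set must make some vertex of the remainder lose edges, and only
  vertices outside \<^term>\<open>cubic\<close> can.\<close>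

lemma collapse:
  assumes "closed X" "X \<noteq> {}" "X \<noteq> V"
  shows "\<exists>v\<in>V - cubic. card (nb v - X) \<le> 2"
proof -
  have XV: "X \<subseteq> V" using assms(1) cubic_V by (auto simp: closed_def)
  obtain v where v: "v \<in> V - X" "card (nb v \<inter> (V - X)) \<le> 2"
    using low_degree_nb[of "V - X"] XV assms by blast
  moreover have "nb v \<inter> (V - X) = nb v - X" using nb_V by blast
  ultimately have le: "card (nb v - X) \<le> 2" by simp
  have "v \<notin> cubic"
  proof
    assume v': "v \<in> cubic"
    then have "nb v - X = nb v" using assms(1) v(1) nb_sym unfolding closed_def by blast
    then show False using le v' by (simp add: card_nb cubic_def)
  qed
  then show ?thesis using v(1) le by blast
qed

lemma component_cubic: "component C \<Longrightarrow> C \<subseteq> cubic"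
  by (simp add: component_def closed_def)

lemma fin_component: "component C \<Longrightarrow> finite C"
  using component_cubic cubic_V finV by (meson finite_subset)

lemma fin_components: "finite {C. component C}"
  by (rule finite_subset[of _ "Pow cubic"])
    (use cubic_V finV in \<open>auto simp: component_def closed_def intro: finite_subset\<close>)

lemma Union_components: "\<Union>{C. component C} = cubic"
proof
  show "\<Union>{C. component C} \<subseteq> cubic" by (auto simp: component_def closed_def)
  show "cubic \<subseteq> \<Union>{C. component C}" using component_exists by blast
qed

text \<open>Every edge meets some component, so with b hubs and k components 2n - 2 is at most 2(n -
  b) + k.\<close>

lemma many_components: "2 * card (V - cubic) \<le> card {C. component C} + 2"
proof -
  let ?K = "{C. component C}"
  have "E = (\<Union>C\<in>?K. touch C)"
  proof -
    have "touch (\<Union>?K) = (\<Union>C\<in>?K. touch C)" by (auto simp: touch_def)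
    then show ?thesis by (simp only: touch_cubic Union_components)
  qed
  then have "card E \<le> (\<Sum>C\<in>?K. card (touch C))"
    using card_UN_le[OF fin_components, of touch] by simp
  also have "\<dots> \<le> (\<Sum>C\<in>?K. 2 * card C + 1)"
    using card_touch_component by (intro sum_mono) simp
  also have "\<dots> = 2 * (\<Sum>C\<in>?K. card C) + card ?K"
    by (simp add: sum_Suc sum_distrib_left)
  also have "(\<Sum>C\<in>?K. card C) = card (\<Union>?K)"
  proof (rule card_Union_disjoint[symmetric])
    show "pairwise disjnt ?K" using component_disjoint by (simp add: pairwise_def disjnt_def)
    show "finite C" if "C \<in> ?K" for C using that fin_component by simp
  qed
  finally show ?thesis using card_E card_cubic Union_components by simp
qed

text \<open>With at least three hubs, choosing for each component a hub that keeps at most two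
  neighbours outside it is injective. The number of components is then at most b, while
  \<open>many_components\<close> demands at least 2b - 2.\<close>

lemma card_big_le: "card (V - cubic) \<le> 2"
proof (rule ccontr)
  assume "\<not> card (V - cubic) \<le> 2"
  then have b3: "3 \<le> card (V - cubic)" by simp
  define f where "f C = (SOME v. v \<in> V - cubic \<and> card (nb v - C) \<le> 2)" for C
  have f: "f C \<in> V - cubic" "card (nb (f C) - C) \<le> 2" if C: "component C" for C
  proof -
    have "C \<subseteq> cubic" using C by (auto simp: component_def closed_def)
    then have "C \<noteq> V" using b3 by (auto simp: Diff_eq_empty_iff[THEN iffD2])
    then have "\<exists>v. v \<in> V - cubic \<and> card (nb v - C) \<le> 2"
      using collapse[of C] C by (auto simp: component_def)
    then have "f C \<in> V - cubic \<and> card (nb (f C) - C) \<le> 2"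
      unfolding f_def by (rule someI_ex)
    then show "f C \<in> V - cubic" "card (nb (f C) - C) \<le> 2" by auto
  qed
  have "inj_on f {C. component C}"
  proof (rule inj_onI, rule ccontr)
    fix C D assume "C \<in> {C. component C}" "D \<in> {C. component C}" and eq: "f C = f D" and ne: "C \<noteq> D"
    then have C: "component C" and D: "component D" by auto
    let ?v = "f C"
    have dis: "C \<inter> D = {}" using component_disjoint C D ne by blast
    have sub: "C \<subseteq> cubic" "D \<subseteq> cubic" using C D by (auto simp: component_def closed_def)
    have fin: "finite C" "finite D" using sub cubic_V finV by (meson finite_subset)+
    have vb: "?v \<in> V" "?v \<notin> cubic" using f(1)[OF C] by auto
    then have d4: "4 \<le> card (nb ?v)" using deg_ge[of ?v] by (auto simp: cubic_def card_nb)
    \<comment> \<open>Disjointness of \<open>C\<close> and \<open>D\<close> means that each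
      neighbour misses one of them. Two sets of size at most 2 cover four or more elements only if
      they are disjoint, so no neighbour misses both.\<close>
    have "nb ?v = (nb ?v - C) \<union> (nb ?v - D)" using dis by auto
    moreover have "nb ?v \<subseteq> C \<union> D"
    proof -
      have "card ((nb ?v - C) \<union> (nb ?v - D)) + card ((nb ?v - C) \<inter> (nb ?v - D))
          = card (nb ?v - C) + card (nb ?v - D)"
        by (rule card_Un_Int[symmetric]) auto
      then have "card ((nb ?v - C) \<inter> (nb ?v - D)) = 0"
        using arg_cong[OF calculation, of card] d4 f(2)[OF C] f(2)[OF D, folded eq] by linarith
      then show ?thesis by auto
    qed
    ultimately have nbsub: "nb ?v \<subseteq> C \<union> D" by simp
    let ?T = "insert ?v (C \<union> D)"
    \<comment> \<open>All neighbours of the hub lie in the two components, so adding it brings no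
      new edge. The set then touches one edge fewer than \<open>card_touch_ge\<close>
      requires.\<close>
    have "touch ?T \<subseteq> touch C \<union> touch D"
    proof
      fix e assume e: "e \<in> touch ?T"
      show "e \<in> touch C \<union> touch D"
      proof (cases "?v \<in> e")
        case True
        then obtain y where "e = {?v, y}" "y \<in> nb ?v" using edge_pair e by (auto simp: touch_def)
        then show ?thesis using nbsub e by (auto simp: touch_def)
      qed (use e in \<open>auto simp: touch_def\<close>)
    qed
    then have "card (touch ?T) \<le> card (touch C \<union> touch D)" by (intro card_mono) auto
    also have "\<dots> \<le> card (touch C) + card (touch D)" by (rule card_Un_le)
    also have "\<dots> \<le> 2 * (card C + card D) + 2"
      using card_touch_component[OF C] card_touch_component[OF D] by simp
    finally have up: "card (touch ?T) \<le> 2 * (card C + card D) + 2" .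
    have cT: "card ?T = Suc (card C + card D)"
      using vb sub fin dis by (subst card_insert_disjoint) (auto simp: card_Un_disjoint)
    have "card (C \<union> D) \<le> card cubic"
      using sub cubic_V finV by (intro card_mono) (auto intro: finite_subset)
    \<comment> \<open>At least two hubs other than \<open>f C\<close> lie outside
      \<open>?T\<close>.\<close>
    then have "card ?T + 2 \<le> card V"
      using cT card_cubic b3 fin dis by (simp add: card_Un_disjoint)
    then show False using card_touch_ge[of ?T] up cT vb sub cubic_V by auto
  qed
  then have "card {C. component C} \<le> card (V - cubic)"
    using f(1) finV by (intro card_inj_on_le[of f]) auto
  then show False using many_components b3 by simp
qed

section \<open>Paths, cycles and connectedness\<close>

abbreviation path :: "'a list \<Rightarrow> bool" where "path \<equiv> successively (\<lambda>x y. y \<in> nb x)"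

definition cycle :: "'a list \<Rightarrow> bool" where
  "cycle vs \<longleftrightarrow> 3 \<le> length vs \<and> distinct vs \<and> path vs \<and> hd vs \<in> nb (last vs)"

text \<open>Connectedness is phrased through sets closed under adjacency, so that it applies
  directly to the vertex set of a longest path.\<close>

definition connected_on :: "'a set \<Rightarrow> bool" where
  "connected_on C \<longleftrightarrow> (\<forall>X\<subseteq>C. X \<noteq> {} \<longrightarrow> (\<forall>x\<in>X. nb x \<inter> C \<subseteq> X) \<longrightarrow> X = C)"

lemma path_rev: "path (rev P) = path P"
  by (simp add: nb_sym cong: successively_cong)

lemma path_take: "path P \<Longrightarrow> path (take k P)"
  by (metis append_take_drop_id successively_append_iff)

lemma component_connected: assumes "component C" shows "connected_on C"
  unfolding connected_on_def
proof (intro allI impI)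
  fix X assume X: "X \<subseteq> C" "X \<noteq> {}" "\<forall>x\<in>X. nb x \<inter> C \<subseteq> X"
  have "closed X" unfolding closed_def
  proof (intro conjI ballI)
    show "X \<subseteq> cubic" using X(1) component_cubic[OF assms] by blast
    show "nb x \<inter> cubic \<subseteq> X" if "x \<in> X" for x
    proof -
      have "nb x \<inter> cubic \<subseteq> C" using that X(1) assms unfolding component_def closed_def by blast
      then show ?thesis using X(3) that by blast
    qed
  qed
  then show "X = C" using assms X unfolding component_def by blast
qed

text \<open>The vertices of a longest path form a set closed under adjacency: an end has no
  neighbour off the path by maximality, an inner vertex by the degree bound.\<close>

lemma hamiltonian_path:
  assumes finC: "finite C" and ne: "C \<noteq> {}" and con: "connected_on C"
    and two: "\<And>x. x \<in> C \<Longrightarrow> card (nb x \<inter> C) \<le> 2"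
  shows "\<exists>P. distinct P \<and> set P = C \<and> path P"
proof -
  let ?Q = "\<lambda>P. P \<noteq> [] \<and> distinct P \<and> set P \<subseteq> C \<and> path P"
  obtain x0 where x0: "x0 \<in> C" using ne by blast
  have bd: "\<forall>P. ?Q P \<longrightarrow> length P < Suc (card C)"
    using finC by (metis card_mono distinct_card less_Suc_eq_le)
  obtain P where P: "?Q P" and mx: "\<And>P'. ?Q P' \<Longrightarrow> length P' \<le> length P"
    using ex_has_greatest_nat[of ?Q "[x0]" length "Suc (card C)"] x0 bd by auto
  have "nb x \<inter> C \<subseteq> set P" if x: "x \<in> set P" for x
  proof (rule ccontr)
    assume "\<not> nb x \<inter> C \<subseteq> set P"
    then obtain y where y: "y \<in> nb x" "y \<in> C" "y \<notin> set P" by blast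
    obtain xs ys where sp: "P = xs @ x # ys" using x split_list by metis
    have "xs \<noteq> []"
    proof
      assume "xs = []"
      then have "?Q (y # P)" using P y sp nb_sym by (auto simp: successively_Cons)
      then show False using mx[of "y # P"] by simp
    qed
    moreover have "ys \<noteq> []"
    proof
      assume "ys = []"
      then have "?Q (P @ [y])" using P y sp by (auto simp: successively_append_iff)
      then show False using mx[of "P @ [y]"] by simp
    qed
    ultimately have mem: "last xs \<in> set xs" "hd ys \<in> set ys" by simp_all
    \<comment> \<open>The predecessor, the successor and \<open>y\<close> would be three neighbours
      of \<open>x\<close> inside \<open>C\<close>.\<close>
    have "{last xs, hd ys, y} \<subseteq> nb x \<inter> C"
      using P sp mem y \<open>xs \<noteq> []\<close> \<open>ys \<noteq> []\<close> nb_sym[of x "last xs"]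
      by (auto simp: successively_append_iff successively_Cons)
    then have le: "card {last xs, hd ys, y} \<le> card (nb x \<inter> C)" by (intro card_mono) auto
    have "last xs \<noteq> hd ys" using mem P sp by fastforce
    moreover have "last xs \<noteq> y" "hd ys \<noteq> y" using mem y(3) sp by force+
    ultimately have "card {last xs, hd ys, y} = 3" by simp
    then show False using le two[of x] P x by force
  qed
  then have "set P = C" using con P unfolding connected_on_def by (metis set_empty)
  then show ?thesis using P by blast
qed

section \<open>At most one hub: wheels\<close>

text \<open>Summing degrees gives \<open>v\<close> degree 2(2n - 2) - 3(n - 1) = n - 1, so it is
  joined to the whole rim \<open>V - {v}\<close>. The rim is connected with degrees at most 2 and
  thus has a Hamiltonian path; \<open>v\<close> closes any initial segment of at least two vertices
  into a cycle.\<close>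

lemma wheel_cycles:
  assumes hub: "\<And>x. x \<in> V - {v} \<Longrightarrow> deg x = 3" and v: "v \<in> V" and i: "3 \<le> i" "i \<le> card V"
  shows "\<exists>vs. cycle vs \<and> length vs = i"
proof -
  let ?R = "V - {v}"
  have finR: "finite ?R" and cR: "card ?R + 1 = card V" using finV v card_V by auto
  have "{} \<notin> E" using edgeD by fastforce
  then have "inside V = E" "touch V = E"
    using edgeD by (auto simp: inside_def touch_def Int_absorb2)
  then have "(\<Sum>x\<in>V. deg x) = 2 * card E" using sum_deg[of V] by simp
  moreover have "(\<Sum>x\<in>V. deg x) = deg v + (\<Sum>x\<in>?R. 3)"
    using v finV hub by (subst sum.remove[of V v]) auto
  ultimately have "card (nb v) = card ?R"
    using card_E cR by (simp add: card_nb)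
  moreover have "nb v \<subseteq> ?R" using nb_V by blast
  ultimately have nbv: "nb v = ?R" using finR card_subset_eq by metis
  have two: "card (nb x \<inter> ?R) \<le> 2" if x: "x \<in> ?R" for x
  proof -
    have "v \<in> nb x" using nbv nb_sym x by blast
    moreover have "nb x \<inter> ?R = nb x - {v}" using nb_V by blast
    ultimately show ?thesis using hub[OF x] by (simp add: card_nb)
  qed
  have con: "connected_on ?R"
    unfolding connected_on_def
  proof (intro allI impI, rule ccontr)
    fix X assume X: "X \<subseteq> ?R" "X \<noteq> {}" "\<forall>x\<in>X. nb x \<inter> ?R \<subseteq> X" "X \<noteq> ?R"
    have far: "3 \<le> card (nb z)" "nb z \<inter> X = {}" if z: "z \<in> ?R - X" for z
    proof -
      show "3 \<le> card (nb z)" using z deg_ge card_nb by auto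
      show "nb z \<inter> X = {}" using z X(3) nb_sym by blast
    qed
    have "V - X \<subseteq> V" "V - X \<noteq> V" "V - X \<noteq> {}" using X v by blast+
    \<comment> \<open>Deleting \<open>X\<close> must leave a vertex of low degree, yet a rim vertex
      outside \<open>X\<close> loses no neighbour.\<close>
    then obtain u where u: "u \<in> V - X" "card (nb u \<inter> (V - X)) \<le> 2"
      using low_degree_nb by blast
    show False
    proof (cases "u = v")
      case False
      then have "u \<in> ?R - X" using u(1) by blast
      moreover then have "nb u \<inter> (V - X) = nb u" using far(2)[of u] nb_V by blast
      ultimately show False using u(2) far(1)[of u] by simp
    next
      case True
      obtain z where z: "z \<in> ?R - X" using X by blast
      \<comment> \<open>The hub still sees \<open>z\<close> and the neighbours of \<open>z\<close>
        other than \<open>v\<close>, at least three vertices in all.\<close>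
      have "insert z (nb z - {v}) \<subseteq> nb v \<inter> (V - X)"
        using z far(2)[OF z] nbv nb_V by blast
      then have "card (insert z (nb z - {v})) \<le> card (nb v \<inter> (V - X))" by (intro card_mono) auto
      moreover have "card (insert z (nb z - {v})) = Suc (card (nb z - {v}))"
        using nb_V by (intro card_insert_disjoint) auto
      moreover have "card (nb z) \<le> Suc (card (nb z - {v}))"
        by (simp add: card_Diff_singleton_if) arith
      ultimately show False using u(2) far(1)[OF z] True by simp
    qed
  qed
  have "card ?R \<noteq> 0" using cR card_V by linarith
  then have "?R \<noteq> {}" by force
  then obtain P where P: "distinct P" "set P = ?R" "path P"
    using hamiltonian_path[OF finR _ con two] by blast
  let ?L = "take (i - 1) P"
  have len: "length ?L = i - 1" using distinct_card[OF P(1)] P(2) cR i by simp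
  then have "?L \<noteq> []" using i by auto
  then have hl: "hd ?L \<in> ?R" "last ?L \<in> ?R"
    using P(2) by (metis hd_in_set last_in_set in_set_takeD)+
  have "cycle (v # ?L)"
    unfolding cycle_def
  proof (intro conjI)
    show "3 \<le> length (v # ?L)" using len i by simp
    show "distinct (v # ?L)" using P by (auto dest: in_set_takeD)
    show "path (v # ?L)" using hl nbv path_take[OF P(3)] by (simp add: successively_Cons)
    show "hd (v # ?L) \<in> nb (last (v # ?L))" using hl(2) nbv nb_sym \<open>?L \<noteq> []\<close> by auto
  qed
  then show ?thesis using len i by (intro exI[of _ "v # ?L"]) simp
qed

section \<open>Two hubs\<close>

text \<open>The common shape of the cycles of length at least 4 when there are two hubs: one segment
  from each component, separated by the hubs.\<close>

lemma cycle_join: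
  assumes "distinct P" "distinct Q" "path P" "path Q" "P \<noteq> []" "Q \<noteq> []"
    and "set P \<inter> set Q = {}" "{a, b} \<inter> (set P \<union> set Q) = {}" "a \<noteq> b"
    and "hd P \<in> nb a" "last P \<in> nb b" "hd Q \<in> nb b" "last Q \<in> nb a"
  shows "cycle (a # P @ b # Q)"
proof -
  have "3 \<le> length (a # P @ b # Q)" using assms(5) by (cases P) simp_all
  moreover have "distinct (a # P @ b # Q)" using assms(1,2,7-9) by auto
  moreover have "b \<in> nb (last P)" "a \<in> nb (last Q)" using assms(11,13) nb_sym by blast+
  ultimately show ?thesis using assms(3-6,10,12)
    by (simp add: cycle_def successively_append_iff successively_Cons)
qed

text \<open>Counting the edges at a component forces equality everywhere: \<^term>\<open>u\<close> is joined to
  all of it, and a neighbour of \<^term>\<open>w\<close> is too saturated to be an inner vertex of the path.\<close>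

lemma component_path:
  assumes hubs: "V - cubic = {u, w}" and uw: "u \<noteq> w" and C: "component C"
    and w2: "card (nb w \<inter> C) \<le> 2"
  shows "C \<subseteq> nb u"
    and "\<exists>P. distinct P \<and> set P = C \<and> path P \<and> 2 \<le> length P \<and> hd P \<in> nb w"
proof -
  have sub: "C \<subseteq> cubic" "C \<subseteq> V" using component_cubic[OF C] cubic_V by blast+
  have finC: "finite C" and ne: "C \<noteq> {}" using fin_component C by (auto simp: component_def)
  have nuw: "u \<notin> C" "w \<notin> C" using hubs sub by blast+
  have nbC: "nb x \<subseteq> insert u (insert w C)" if x: "x \<in> C" for x
  proof
    fix y assume "y \<in> nb x"
    then show "y \<in> insert u (insert w C)"
    proof (cases "y \<in> cubic")
      case True
      then show ?thesis using C x \<open>y \<in> nb x\<close> unfolding component_def closed_def by blast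
    next
      case False
      then have "y \<in> V - cubic" using nb_V[OF \<open>y \<in> nb x\<close>] by blast
      then show ?thesis using hubs by auto
    qed
  qed
  have "card C \<le> card cubic" using sub cubic_V finV by (intro card_mono) (auto intro: finite_subset)
  then have "card C + 2 \<le> card V" using card_cubic hubs uw by simp
  \<comment> \<open>The two hubs lie outside \<open>C\<close>, so the lower bound applies and meets
    the upper bound for components.\<close>
  then have t: "2 * card C + 1 = card (touch C)"
    using card_touch_component[OF C] card_touch_ge[OF sub(2) ne] by simp
  have "(\<Sum>x\<in>C. deg x) = (\<Sum>x\<in>C. 3)" using sub by (intro sum.cong) (auto simp: cubic_def)
  then have tot: "3 * card C = card (touch C) + card (inside C)" using sum_deg[OF sub(2)] by simp
  have "touch C \<subseteq> inside C \<union> ((\<lambda>x. {u, x}) ` (nb u \<inter> C) \<union> (\<lambda>x. {w, x}) ` (nb w \<inter> C))"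
  proof
    fix e assume e: "e \<in> touch C"
    then obtain x where x: "x \<in> e" "x \<in> C" "e \<in> E" by (auto simp: touch_def)
    then obtain y where y: "e = {x, y}" "y \<in> nb x" using edge_pair by blast
    then have "y = u \<or> y = w \<or> y \<in> C" using nbC x by blast
    then show "e \<in> inside C \<union> ((\<lambda>x. {u, x}) ` (nb u \<inter> C) \<union> (\<lambda>x. {w, x}) ` (nb w \<inter> C))"
      using x y nb_sym by (auto simp: inside_def insert_commute)
  qed
  then have "card (touch C) \<le>
      card (inside C \<union> ((\<lambda>x. {u, x}) ` (nb u \<inter> C) \<union> (\<lambda>x. {w, x}) ` (nb w \<inter> C)))"
    by (intro card_mono) auto
  also have "\<dots> \<le> card (inside C) + card ((\<lambda>x. {u, x}) ` (nb u \<inter> C) \<union> (\<lambda>x. {w, x}) ` (nb w \<inter> C))"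
    by (rule card_Un_le)
  also have "card ((\<lambda>x. {u, x}) ` (nb u \<inter> C) \<union> (\<lambda>x. {w, x}) ` (nb w \<inter> C)) \<le>
      card ((\<lambda>x. {u, x}) ` (nb u \<inter> C)) + card ((\<lambda>x. {w, x}) ` (nb w \<inter> C))"
    by (rule card_Un_le)
  also have "card ((\<lambda>x. {u, x}) ` (nb u \<inter> C)) \<le> card (nb u \<inter> C)" by (rule card_image_le) simp
  also have "card ((\<lambda>x. {w, x}) ` (nb w \<inter> C)) \<le> card (nb w \<inter> C)" by (rule card_image_le) simp
  finally have "card (touch C) \<le> card (inside C) + (card (nb u \<inter> C) + card (nb w \<inter> C))" by simp
  moreover have "card (nb u \<inter> C) \<le> card C" using finC by (intro card_mono) auto
  \<comment> \<open>With c the size of \<open>C\<close>, there are 3c - (2c + 1) = c - 1 edges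
    inside, so at least c + 2 go to the hubs. At most c of these go to \<open>u\<close> and at most
    2 to \<open>w\<close>.\<close>
  ultimately have eqs: "card (nb u \<inter> C) = card C" "card (nb w \<inter> C) = 2"
    using t tot w2 by linarith+
  then have "nb u \<inter> C = C" using finC by (intro card_subset_eq) auto
  then show Cu: "C \<subseteq> nb u" by blast
  have deg3: "card (nb x) = 3" if "x \<in> C" for x
    using that sub by (auto simp: card_nb cubic_def)
  have two: "card (nb x \<inter> C) \<le> 2" if x: "x \<in> C" for x
  proof -
    have "u \<in> nb x" using Cu x nb_sym by blast
    then have "card (nb x - {u}) = 2" using deg3[OF x] by simp
    moreover have "card (nb x \<inter> C) \<le> card (nb x - {u})" using nuw by (intro card_mono) auto
    ultimately show ?thesis by simp
  qed
  obtain P where P: "distinct P" "set P = C" "path P"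
    using hamiltonian_path[OF finC ne component_connected[OF C] two] by blast
  have "card (nb w \<inter> C) \<le> card C" using finC by (intro card_mono) auto
  then have len: "2 \<le> length P" using eqs(2) distinct_card[OF P(1)] P(2) by simp
  have "nb w \<inter> C \<noteq> {}" using eqs(2) by force
  then obtain x where x: "x \<in> nb w" "x \<in> C" by blast
  \<comment> \<open>Two of the three edges at \<open>x\<close> go to the hubs, leaving one for the
    path.\<close>
  have "card (nb x - {u} - {w}) = 1"
    using deg3[OF x(2)] x Cu nb_sym[of x u] nb_sym[of x w] uw by auto
  moreover have "card (nb x \<inter> C) \<le> card (nb x - {u} - {w})" using nuw by (intro card_mono) auto
  ultimately have one: "card (nb x \<inter> C) \<le> 1" by simp
  obtain xs ys where sp: "P = xs @ x # ys" using x P(2) split_list by metis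
  have "xs = [] \<or> ys = []"
  proof (rule ccontr)
    assume n: "\<not> (xs = [] \<or> ys = [])"
    then have mem: "last xs \<in> set xs" "hd ys \<in> set ys" by simp_all
    have "{last xs, hd ys} \<subseteq> nb x \<inter> C"
      using P sp mem n nb_sym[of x "last xs"]
      by (auto simp: successively_append_iff successively_Cons)
    then have "card {last xs, hd ys} \<le> card (nb x \<inter> C)" by (intro card_mono) auto
    moreover have "last xs \<noteq> hd ys" using mem P(1) sp by fastforce
    ultimately show False using one by simp
  qed
  then have "hd P = x \<or> hd (rev P) = x" using sp by auto
  then show "\<exists>P. distinct P \<and> set P = C \<and> path P \<and> 2 \<le> length P \<and> hd P \<in> nb w"
  proof
    assume "hd P = x"
    then show ?thesis using P len x(1) by blast
  next
    assume "hd (rev P) = x"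
    then show ?thesis using P len x(1) path_rev by (intro exI[of _ "rev P"]) simp
  qed
qed

lemma touch_disjoint:
  assumes "closed X" "closed Y" "X \<inter> Y = {}" shows "touch X \<inter> touch Y = {}"
proof (rule ccontr)
  assume "touch X \<inter> touch Y \<noteq> {}"
  then obtain e x y where e: "e \<in> E" "x \<in> e" "x \<in> X" "y \<in> e" "y \<in> Y" by (auto simp: touch_def)
  then obtain z where z: "e = {x, z}" "z \<in> nb x" using edge_pair by blast
  then have "y = z" using e assms(3) by blast
  then show False using z e assms unfolding closed_def by blast
qed

text \<open>The count of components yields at least two. A nonempty remainder would give three
  disjoint closed sets whose edge sets are disjoint too, hence at least 2(n - 2) + 3 edges, one too
  many.\<close>

lemma two_components:
  assumes two: "card (V - cubic) = 2"
  obtains C D where "component C" "component D" "C \<inter> D = {}" "C \<union> D = cubic"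
proof -
  have "\<not> card {C. component C} \<le> Suc 0" using many_components two by simp
  then have "\<exists>C D. component C \<and> component D \<and> C \<noteq> D"
    by (simp add: card_le_Suc0_iff_eq[OF fin_components])
  then obtain C D where CD: "component C" "component D" "C \<noteq> D" by blast
  have dis: "C \<inter> D = {}" using component_disjoint CD by blast
  have cl: "closed C" "closed D" "C \<noteq> {}" "D \<noteq> {}" using CD by (auto simp: component_def)
  have sub: "C \<subseteq> cubic" "D \<subseteq> cubic" using CD component_cubic by auto
  let ?X = "cubic - C - D"
  have clX: "closed ?X" using cl closed_Diff closed_cubic by blast
  have fin: "finite cubic" using cubic_V finV by (rule finite_subset)
  have "?X = {}"
  proof (rule ccontr)
    assume X: "?X \<noteq> {}"
    have ge: "2 * card Y + 1 \<le> card (touch Y)" if "Y \<subseteq> cubic" "Y \<noteq> {}" for Y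
    proof -
      have "card Y \<le> card cubic" using that fin by (intro card_mono)
      then show ?thesis using card_touch_ge[of Y] that cubic_V card_cubic two by simp
    qed
    have "touch C \<inter> touch D = {}" by (rule touch_disjoint[OF cl(1,2) dis])
    moreover have "(touch C \<union> touch D) \<inter> touch ?X = {}"
      using touch_disjoint[OF cl(1) clX] touch_disjoint[OF cl(2) clX] by blast
    ultimately have "card (touch C \<union> touch D \<union> touch ?X)
        = card (touch C) + card (touch D) + card (touch ?X)"
      by (simp add: card_Un_disjoint)
    moreover have "card (touch C \<union> touch D \<union> touch ?X) \<le> card E"
      using finE by (intro card_mono) (auto simp: touch_def)
    moreover have "card cubic = card C + card D + card ?X"
    proof -
      have "card (C \<union> D \<union> ?X) = card (C \<union> D) + card ?X"
        using fin sub by (intro card_Un_disjoint) (auto intro: finite_subset)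
      moreover have "card (C \<union> D) = card C + card D"
        using dis fin sub by (intro card_Un_disjoint) (auto intro: finite_subset)
      moreover have "C \<union> D \<union> ?X = cubic" using sub by blast
      ultimately show ?thesis by simp
    qed
    ultimately show False
      using ge[OF sub(1) cl(3)] ge[OF sub(2) cl(4)] ge[OF _ X] card_E card_cubic two by auto
  qed
  then show thesis using that[OF CD(1,2) dis] sub by blast
qed

text \<open>Each component has a hub with at most two neighbours in it, so
  \<open>component_path\<close> joins the other hub to all of it. Initial segments of the two paths
  can therefore be cut anywhere and still be closed up through the hubs.\<close>

lemma two_hub_cycles:
  assumes two: "card (V - cubic) = 2" and i: "3 \<le> i" "i \<le> card V"
  shows "\<exists>vs. cycle vs \<and> length vs = i"
proof -
  obtain C D where C: "component C" and D: "component D" and dis: "C \<inter> D = {}"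
    and un: "C \<union> D = cubic"
    using two_components[OF two] by blast
  have weak: "\<exists>v\<in>V - cubic. card (nb v \<inter> Y) \<le> 2"
    if X: "component X" and Y: "Y \<inter> X = {}" for X Y
  proof -
    have "X \<noteq> V" using component_cubic[OF X] two by (metis Diff_eq_empty_iff card.empty zero_neq_numeral)
    then obtain v where v: "v \<in> V - cubic" "card (nb v - X) \<le> 2"
      using collapse[of X] X by (auto simp: component_def)
    have "card (nb v \<inter> Y) \<le> card (nb v - X)" using Y by (intro card_mono) auto
    then have "card (nb v \<inter> Y) \<le> 2" using v(2) by linarith
    then show ?thesis using v(1) by blast
  qed
  obtain a where a: "a \<in> V - cubic" "card (nb a \<inter> D) \<le> 2" using weak[OF C, of D] dis by blast
  obtain b where ab: "V - cubic = {a, b}" "a \<noteq> b"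
    using two a(1) by (metis card_2_iff doubleton_eq_iff insertE singletonD)
  have ba: "V - cubic = {b, a}" "b \<noteq> a" using ab by auto
  obtain Q where Q: "distinct Q" "set Q = D" "path Q" "2 \<le> length Q" "hd Q \<in> nb a"
    using component_path(2)[OF ba D a(2)] by blast
  have Db: "D \<subseteq> nb b" using component_path(1)[OF ba D a(2)] .
  have off: "a \<notin> C \<union> D" "b \<notin> C \<union> D" using ab un by blast+
  obtain c where c: "c \<in> {a, b}" "card (nb c \<inter> C) \<le> 2" using weak[OF D, of C] dis ab by blast
  show ?thesis
  proof (cases "i = 3")
    \<comment> \<open>A cycle through both hubs and both components has length at least 4, so the
      triangle is taken from \<open>b\<close> and an edge of \<open>Q\<close>.\<close>
    case True
    obtain x y zs where xy: "Q = x # y # zs"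
      using Q(4) by (metis One_nat_def Suc_1 Suc_le_length_iff)
    have "cycle [b, x, y]"
      using Q xy off(2) Db nb_sym[of b y] by (auto simp: cycle_def)
    then show ?thesis using True by (intro exI[of _ "[b, x, y]"]) simp
  next
    case False
    have main: "\<exists>vs. cycle vs \<and> length vs = i"
      if P: "distinct P" "set P = C" "path P" "2 \<le> length P" and
        join: "\<And>P' Q'. \<lbrakk>P' \<noteq> []; Q' \<noteq> []; \<exists>k. P' = take k P; \<exists>l. Q' = take l Q\<rbrakk> \<Longrightarrow>
          \<exists>vs. cycle vs \<and> length vs = length P' + length Q' + 2" for P
    proof -
      have "card V = length P + length Q + 2"
        using card_cubic two un dis distinct_card[OF P(1)] distinct_card[OF Q(1)] P(2) Q(2)
          card_Un_disjoint[of C D] fin_component C D by simp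
      \<comment> \<open>As much of \<open>P\<close> as possible is used while one vertex is reserved
        for \<open>Q\<close> and two for the hubs.\<close>
      moreover define k where "k = min (length P) (i - 3)"
      moreover define l where "l = i - 2 - k"
      ultimately have kl: "1 \<le> k" "k \<le> length P" "1 \<le> l" "l \<le> length Q" "k + l + 2 = i"
        using i False P(4) Q(4) by (auto simp: min_def split: if_splits)
      have "take k P \<noteq> []" "take l Q \<noteq> []" using kl P(4) Q(4) by auto
      then show ?thesis using join[of "take k P" "take l Q"] kl by auto
    qed
    show ?thesis
    proof (cases "c = a")
      case True
      then have c2: "card (nb a \<inter> C) \<le> 2" using c by simp
      obtain P where P: "distinct P" "set P = C" "path P" "2 \<le> length P" "hd P \<in> nb a"
        using component_path(2)[OF ba C c2] by blast
      have Cb: "C \<subseteq> nb b" using component_path(1)[OF ba C c2] .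
      show ?thesis
      proof (rule main[OF P(1-4)])
        fix P' Q' assume ne: "P' \<noteq> []" "Q' \<noteq> []" and "\<exists>k. P' = take k P" "\<exists>l. Q' = take l Q"
        then obtain k l where kl: "P' = take k P" "Q' = take l Q" by blast
        have s: "set P' \<subseteq> C" "set Q' \<subseteq> D" using kl P(2) Q(2) by (auto dest: in_set_takeD)
        have h: "hd P' = hd P" "hd Q' = hd Q" using kl ne by auto
        have m: "last P' \<in> C" "last Q' \<in> D" using s ne by auto
        \<comment> \<open>Both paths start next to \<open>a\<close>, so one of them is traversed
          backwards.\<close>
        have "cycle (a # P' @ b # rev Q')"
        proof (rule cycle_join)
          show "path (rev Q')" using Q(3) kl path_take path_rev by blast
          show "set P' \<inter> set (rev Q') = {}" "{a, b} \<inter> (set P' \<union> set (rev Q')) = {}"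
            using s dis off by auto
          show "last P' \<in> nb b" "hd (rev Q') \<in> nb b" using m Cb Db by (auto simp: hd_rev)
          show "hd P' \<in> nb a" "last (rev Q') \<in> nb a" using h P(5) Q(5) by (auto simp: last_rev)
        qed (use kl P Q ne ab path_take in auto)
        then show "\<exists>vs. cycle vs \<and> length vs = length P' + length Q' + 2"
          by (intro exI[of _ "a # P' @ b # rev Q'"]) simp
      qed
    next
      case False
      then have c2: "card (nb b \<inter> C) \<le> 2" using c by auto
      obtain P where P: "distinct P" "set P = C" "path P" "2 \<le> length P" "hd P \<in> nb b"
        using component_path(2)[OF ab C c2] by blast
      have Ca: "C \<subseteq> nb a" using component_path(1)[OF ab C c2] .
      show ?thesis
      proof (rule main[OF P(1-4)])
        fix P' Q' assume ne: "P' \<noteq> []" "Q' \<noteq> []" and "\<exists>k. P' = take k P" "\<exists>l. Q' = take l Q"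
        then obtain k l where kl: "P' = take k P" "Q' = take l Q" by blast
        have s: "set P' \<subseteq> C" "set Q' \<subseteq> D" using kl P(2) Q(2) by (auto dest: in_set_takeD)
        have h: "hd P' = hd P" "hd Q' = hd Q" using kl ne by auto
        have m: "last P' \<in> C" "last Q' \<in> D" using s ne by auto
        \<comment> \<open>Here \<open>P\<close> starts next to \<open>b\<close> and \<open>Q\<close>
          next to \<open>a\<close>, so both are traversed forwards.\<close>
        have "cycle (b # P' @ a # Q')"
        proof (rule cycle_join)
          show "set P' \<inter> set Q' = {}" "{b, a} \<inter> (set P' \<union> set Q') = {}"
            using s dis off by auto
          show "last P' \<in> nb a" "last Q' \<in> nb b" using m Ca Db by auto
          show "hd P' \<in> nb b" "hd Q' \<in> nb a" using h P(5) Q(5) by auto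
        qed (use kl P Q ne ab path_take in auto)
        then show "\<exists>vs. cycle vs \<and> length vs = length P' + length Q' + 2"
          by (intro exI[of _ "b # P' @ a # Q'"]) simp
      qed
    qed
  qed
qed

lemma all_cycles:
  assumes "3 \<le> i" "i \<le> card V" shows "\<exists>vs. cycle vs \<and> length vs = i"
proof (cases "card (V - cubic) = 2")
  case True then show ?thesis using two_hub_cycles assms by blast
next
  case False
  then have le: "card (V - cubic) \<le> Suc 0" using card_big_le by simp
  \<comment> \<open>If every vertex is cubic, any vertex can serve as the centre of the
    wheel.\<close>
  obtain v where v: "v \<in> V" "V - cubic \<subseteq> {v}"
  proof (cases "V - cubic = {}")
    case True
    obtain v where "v \<in> V" using card_V by fastforce
    then show thesis using that True by blast
  next
    case False
    then obtain v where "v \<in> V - cubic" by blast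
    moreover have "V - cubic \<subseteq> {v}"
      using le calculation card_le_Suc0_iff_eq[of "V - cubic"] finV by blast
    ultimately show thesis using that by blast
  qed
  have "deg x = 3" if "x \<in> V - {v}" for x using that v by (auto simp: cubic_def)
  then show ?thesis using wheel_cycles v assms by blast
qed

end

section \<open>Transfer to graphs as records\<close>

lemma min_degree_ge_iff:
  assumes "finite (verts H)" "verts H \<noteq> {}"
  shows "k \<le> min_degree H \<longleftrightarrow> (\<forall>v\<in>verts H. k \<le> degree H v)"
  using assms by (simp add: min_degree_def)

theorem theorem1p4:
  fixes G :: "'a sgraph" and n :: nat
  assumes "fin_simple_graph G"
    and "card (verts G) = n"
    and "int (card (edges G)) = 2 * int n - 2"
    and "\<not> (\<exists>H. proper_subgraph H G \<and> verts H \<noteq> {} \<and> min_degree H \<ge> 3)"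
  shows "pancyclic G"
  unfolding pancyclic_def
proof (intro allI impI)
  fix i assume i: "3 \<le> i \<and> i \<le> card (verts G)"
  have fin: "finite (verts G)"
    and edge: "\<And>e. e \<in> edges G \<Longrightarrow> e \<subseteq> verts G \<and> card e = 2"
    using assms(1) by (auto simp: fin_simple_graph_def)
  \<comment> \<open>This covers both low-degree conditions of the locale: \<open>F\<close> is either
    the set of edges inside a proper \<open>S\<close>, or all edges but one with \<open>S\<close>
    the full vertex set.\<close>
  have low: "\<exists>v\<in>S. card {e \<in> F. v \<in> e} \<le> 2"
    if S: "S \<subseteq> verts G" "S \<noteq> {}" and F: "F \<subseteq> edges G" "\<And>e. e \<in> F \<Longrightarrow> e \<subseteq> S"
      and ne: "S \<noteq> verts G \<or> F \<noteq> edges G" for S F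
  proof (rule ccontr)
    assume "\<not> ?thesis"
    then have ge: "\<forall>v\<in>S. 3 \<le> card {e \<in> F. v \<in> e}" by (auto simp: not_le)
    let ?H = "\<lparr>verts = S, edges = F\<rparr>"
    have finS: "finite S" using S(1) fin finite_subset by blast
    then have "subgraph ?H G"
      using S F edge by (auto simp: subgraph_def fin_simple_graph_def)
    moreover have "?H \<noteq> G" using ne by auto
    moreover have "3 \<le> min_degree ?H"
      using min_degree_ge_iff[of ?H 3] finS S(2) ge by (simp add: degree_def)
    ultimately show False using assms(4) S(2) by (auto simp: proper_subgraph_def)
  qed
  interpret critical_graph "verts G" "edges G"
  proof
    show "finite (verts G)" by fact
    show "e \<subseteq> verts G \<and> card e = 2" if "e \<in> edges G" for e using edge that .
    show "3 \<le> card (verts G)" using i by simp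
    show "card (edges G) + 2 = 2 * card (verts G)" using assms(2,3) by linarith
    show "\<exists>v\<in>S. card {e \<in> edges G. e \<subseteq> S \<and> v \<in> e} \<le> 2"
      if "S \<subseteq> verts G" "S \<noteq> verts G" "S \<noteq> {}" for S
    proof -
      have "\<exists>v\<in>S. card {e \<in> {e \<in> edges G. e \<subseteq> S}. v \<in> e} \<le> 2"
        by (rule low) (simp_all add: that)
      then show ?thesis by (simp only: mem_Collect_eq conj_assoc)
    qed
    show "\<exists>v\<in>verts G. card {f \<in> edges G - {e}. v \<in> f} \<le> 2" if "e \<in> edges G" for e
    proof (rule low)
      show "verts G \<noteq> {}" using i by force
      show "f \<subseteq> verts G" if "f \<in> edges G - {e}" for f using edge that by blast
    qed (use that in blast)+
  qed
  obtain vs where vs: "cycle vs" "length vs = i" using all_cycles i by blast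
  have n3: "3 \<le> length vs" and dist: "distinct vs" using vs by (auto simp: cycle_def)
  have step: "{vs ! j, vs ! (Suc j mod length vs)} \<in> edges G" if j: "j < length vs" for j
  proof (cases "Suc j < length vs")
    case True
    then show ?thesis using vs(1) by (auto simp: cycle_def successively_conv_nth nb_def)
  next
    case False
    \<comment> \<open>At the last position the index wraps around to 0, which is the closing edge of
      the cycle.\<close>
    then have l: "Suc j = length vs" "vs \<noteq> []" using j by auto
    then have "vs ! j = last vs" by (metis diff_Suc_1 last_conv_nth)
    then show ?thesis using vs(1) l by (auto simp: cycle_def nb_def hd_conv_nth)
  qed
  let ?C = "\<lparr>verts = set vs, edges = {{vs ! j, vs ! (Suc j mod length vs)} | j. j < length vs}\<rparr>"
  have "set vs \<subseteq> verts G"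
  proof
    fix x assume "x \<in> set vs"
    then obtain j where "j < length vs" "x = vs ! j" by (auto simp: in_set_conv_nth)
    then show "x \<in> verts G" using step[of j] edge by blast
  qed
  moreover have "vs ! (Suc j mod length vs) \<in> set vs" if "j < length vs" for j
    using that by (intro nth_mem mod_less_divisor) auto
  ultimately have "subgraph ?C G"
    using step edge by (auto simp: subgraph_def fin_simple_graph_def)
  moreover have "is_cycle ?C" using n3 dist by (auto simp: is_cycle_def)
  moreover have "card (verts ?C) = i" using distinct_card[OF dist] vs(2) by simp
  ultimately show "contains_cycle_of_length G i" unfolding contains_cycle_of_length_def by blast
qed

end
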